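(* Let $f(z)=z+\sum_{k=2}^\infty b_kz^k\in\mathscr{S}^*_\wp$. Then $|b_2|\le1$, $|b_3|\le1$, $|b_4|\le 5/6$ and $|b_5|\le5/8$. The bounds are sharp, with equality for $f_1(z)=z\exp(e^z-1)=z+z^2+z^3+\frac56z^4+\frac58z^5+\cdots$.
   Context: $\mathbb{D}$ is the unit disk; $\mathcal{A}$ is the class of analytic $f$ on $\mathbb{D}$ with $f(0)=0,f'(0)=1$. $f\prec g$ means $f=g\circ\omega$ for analytic $\omega:\mathbb{D}\to\mathbb{D}$, $\omega(0)=0$. $\wp(z)=1+ze^z$, $\mathscr{S}^*_\wp=\{f\in\mathcal{A}:zf'(z)/f(z)\prec\wp(z)\}$. *)

theory Defs
  imports "HOL-Complex_Analysis.Complex_Analysis"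
begin

abbreviation unit_disk :: "complex set" where "unit_disk \<equiv> ball 0 1"

definition classA :: "(complex \<Rightarrow> complex) \<Rightarrow> bool" where
  "classA f \<longleftrightarrow> f holomorphic_on unit_disk \<and> f 0 = 0 \<and> deriv f 0 = 1"

definition subordinate :: "(complex \<Rightarrow> complex) \<Rightarrow> (complex \<Rightarrow> complex) \<Rightarrow> bool" where
  "subordinate g h \<longleftrightarrow> (\<exists>\<omega>. \<omega> holomorphic_on unit_disk \<and> \<omega> ` unit_disk \<subseteq> unit_disk
      \<and> \<omega> 0 = 0 \<and> (\<forall>z\<in>unit_disk. g z = h (\<omega> z)))"

definition wp :: "complex \<Rightarrow> complex" where
  "wp z = 1 + z * exp z"

text \<open>The function z f'(z)/f(z), with its removable value 1 at the origin.\<close>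
definition logderiv_quot :: "(complex \<Rightarrow> complex) \<Rightarrow> complex \<Rightarrow> complex" where
  "logderiv_quot f z = (if z = 0 then 1 else z * deriv f z / f z)"

definition starlike_wp :: "(complex \<Rightarrow> complex) \<Rightarrow> bool" where
  "starlike_wp f \<longleftrightarrow> classA f \<and> (\<forall>z\<in>unit_disk. z \<noteq> 0 \<longrightarrow> f z \<noteq> 0)
      \<and> subordinate (logderiv_quot f) wp"

definition taylor_coeff :: "(complex \<Rightarrow> complex) \<Rightarrow> nat \<Rightarrow> complex" where
  "taylor_coeff f k = (deriv ^^ k) f 0 / of_nat (fact k)"

end

theory Submission
  imports Defs
begin

text \<open>
  Write \<open>\<omega>(z) = c\<^sub>1 z + c\<^sub>2 z\<^sup>2 + \<dots>\<close> for the Schwarz function of the subordination. Comparing coefficients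
  in \<open>z f' = f (1 + \<omega> e\<^sup>\<omega>)\<close> expresses \<open>b\<^sub>2, \<dots>, b\<^sub>5\<close> as polynomials in the \<open>c\<^sub>k\<close>. Since multiplication
  by \<open>\<omega>\<close> contracts the norm of the Hardy space, Rogosinski's inequality
  \<open>\<Sum>k\<le>n. |[z\<^sup>k] \<omega> G|\<^sup>2 \<le> \<Sum>k\<le>n. |[z\<^sup>k] G|\<^sup>2\<close> holds for every power series \<open>G\<close>. For each \<open>n \<le> 5\<close> one
  chooses \<open>G\<close>, with coefficients depending on the \<open>c\<^sub>k\<close>, such that \<open>[z\<^sup>n\<^sup>-\<^sup>1] \<omega> G = (n - 1) b\<^sub>n\<close>; the
  choice is made so that the sums of squares (nearly) telescope, and what remains is controlled by
  \<open>|c\<^sub>2| \<le> 1 - |c\<^sub>1|\<^sup>2\<close>. The function \<open>f\<^sub>1\<close> corresponds to \<open>\<omega>(z) = z\<close>.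
\<close>

section \<open>Mean values on circles and Rogosinski's inequality\<close>

text \<open>On the circle \<open>cnj u = r^2 / u\<close>, so pairing with a conjugated polynomial
  reduces to Cauchy's formula for the single Taylor coefficients. With \<open>h\<close> equal to the
  polynomial itself this is Parseval's identity.\<close>

lemma has_integral_circle_mult_cnj_poly:
  assumes holo: "h holomorphic_on ball 0 1" and H: "h has_fps_expansion H"
    and r: "0 < r" "r < 1"
  shows "((\<lambda>x. h (circlepath 0 r x) * cnj (poly P (circlepath 0 r x))) has_integral
           (\<Sum>k\<le>degree P. fps_nth H k * cnj (coeff P k) * of_real (r ^ (2 * k)))) {0..1}"
proof -
  have "((\<lambda>x. h (circlepath 0 r x) / circlepath 0 r x ^ k) has_integral fps_nth H k) {0..1}" for k
  proof -
    have "h holomorphic_on cball 0 r"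
      by (rule holomorphic_on_subset[OF holo]) (use r in auto)
    then have "((\<lambda>u. h u / (u - 0) ^ Suc k) has_contour_integral
        (2 * pi * \<i> / fact k * (deriv ^^ k) h 0)) (circlepath 0 r)"
      using r by (intro Cauchy_has_contour_integral_higher_derivative_circlepath
          holomorphic_on_imp_continuous_on) (auto intro: holomorphic_on_subset)
    \<comment> \<open>The velocity \<open>2 * pi * \<i> * u\<close> cancels one factor of
      \<open>u ^ Suc k\<close> and the constant in Cauchy's formula.\<close>
    moreover have "vector_derivative (circlepath 0 r) (at x) = 2 * pi * \<i> * circlepath 0 r x" for x
      unfolding vector_derivative_circlepath by (simp add: circlepath)
    ultimately have "((\<lambda>x. h (circlepath 0 r x) / circlepath 0 r x ^ Suc k *
        (2 * pi * \<i> * circlepath 0 r x)) has_integral (2 * pi * \<i> * fps_nth H k)) {0..1}"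
      by (simp only: has_contour_integral fps_nth_fps_expansion[OF H] diff_0_right
          times_divide_eq_left times_divide_eq_right)
    from has_integral_mult_right[OF this, of "1 / (2 * pi * \<i>)"] show ?thesis
      using r by (simp add: circlepath)
  qed
  then have "((\<lambda>x. \<Sum>k\<le>degree P. h (circlepath 0 r x) / circlepath 0 r x ^ k *
      (cnj (coeff P k) * of_real (r ^ (2 * k)))) has_integral
      (\<Sum>k\<le>degree P. fps_nth H k * (cnj (coeff P k) * of_real (r ^ (2 * k))))) {0..1}"
    by (intro has_integral_sum has_integral_mult_left) auto
  moreover have "(\<Sum>k\<le>degree P. h (circlepath 0 r x) / circlepath 0 r x ^ k *
      (cnj (coeff P k) * of_real (r ^ (2 * k)))) =
      h (circlepath 0 r x) * cnj (poly P (circlepath 0 r x))" for x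
  proof -
    define u where "u = circlepath 0 r x"
    have "u \<noteq> 0" using r by (simp add: u_def circlepath)
    have "norm u = r" using r by (simp add: u_def circlepath norm_mult)
    then have "u * cnj u = of_real (r ^ 2)"
      by (metis complex_norm_square)
    then have "cnj u = of_real (r ^ 2) / u"
      using \<open>u \<noteq> 0\<close> by (simp add: field_simps)
    then have "cnj (u ^ k) = of_real (r ^ (2 * k)) / u ^ k" for k
      by (simp add: power_divide power_mult)
    then show ?thesis
      unfolding u_def[symmetric] poly_altdef cnj_sum sum_distrib_left complex_cnj_mult
      by (intro sum.cong) (simp_all add: mult_ac)
  qed
  ultimately show ?thesis
    by (simp add: mult_ac)
qed

lemma poly_has_fps_expansion:
  fixes P :: "complex poly"
  shows "poly P has_fps_expansion fps_of_poly P"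
proof -
  have "eval_fps (fps_of_poly P) = poly P" by (rule ext) simp
  then show ?thesis using eval_fps_has_fps_expansion[of "fps_of_poly P"] by simp
qed

text \<open>Bessel's inequality on the circle of radius \<open>r\<close>, obtained by integrating
  \<open>2 Re (h cnj P) - |P|\<^sup>2 \<le> |h|\<^sup>2 \<le> |G|\<^sup>2\<close> with \<open>h = \<omega> G\<close> and \<open>P\<close> its Taylor polynomial.\<close>

lemma schur_coeff_bound_circle:
  assumes holo: "\<omega> holomorphic_on ball 0 1" and bound: "\<And>z. z \<in> ball 0 1 \<Longrightarrow> norm (\<omega> z) \<le> 1"
    and W: "\<omega> has_fps_expansion W" and r: "0 < r" "r < 1"
  shows "(\<Sum>k\<le>n. (norm (fps_nth (W * fps_of_poly G) k))\<^sup>2 * r ^ (2 * k))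
           \<le> (\<Sum>k\<le>degree G. (norm (coeff G k))\<^sup>2 * r ^ (2 * k))"
proof -
  define h where "h = (\<lambda>z. \<omega> z * poly G z)"
  define H where "H = W * fps_of_poly G"
  have hH: "h has_fps_expansion H"
    unfolding h_def H_def by (intro has_fps_expansion_mult W poly_has_fps_expansion)
  have holh: "h holomorphic_on ball 0 1"
    unfolding h_def by (intro holomorphic_intros holo)
  define P where "P = (\<Sum>k\<le>n. monom (fps_nth H k) k)"
  have coeffP: "coeff P k = (if k \<le> n then fps_nth H k else 0)" for k
    by (simp add: P_def coeff_sum)
  have degP: "degree P \<le> n"
    by (rule degree_le) (simp add: coeffP)
  have ext: "(\<Sum>k\<le>degree P. (norm (coeff P k))\<^sup>2 * r ^ (2 * k)) =
      (\<Sum>k\<le>n. (norm (fps_nth H k))\<^sup>2 * r ^ (2 * k))" (is "_ = ?S")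
    by (rule sum.mono_neutral_cong_left)
       (use degP in \<open>auto simp: coeffP intro: le_degree\<close>)
  \<comment> \<open>Parseval's identity for polynomials: the case \<open>h = poly Q\<close>,
    \<open>P = Q\<close> of the pairing.\<close>
  have poly_int: "((\<lambda>x. (norm (poly Q (circlepath 0 r x)))\<^sup>2) has_integral
      (\<Sum>k\<le>degree Q. (norm (coeff Q k))\<^sup>2 * r ^ (2 * k))) {0..1}" for Q
    using has_integral_Re[OF has_integral_circle_mult_cnj_poly[OF _ poly_has_fps_expansion r,
          of Q Q]]
    by (simp add: holomorphic_intros complex_mult_cnj cmod_power2 del: of_real_power of_real_add)
  have "((\<lambda>x. h (circlepath 0 r x) * cnj (poly P (circlepath 0 r x))) has_integral
           (\<Sum>k\<le>degree P. fps_nth H k * cnj (coeff P k) * of_real (r ^ (2 * k)))) {0..1}"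
    by (rule has_integral_circle_mult_cnj_poly[OF holh hH r])
  also have "(\<Sum>k\<le>degree P. fps_nth H k * cnj (coeff P k) * of_real (r ^ (2 * k))) =
     of_real (\<Sum>k\<le>degree P. (norm (coeff P k))\<^sup>2 * r ^ (2 * k))"
    unfolding of_real_sum
    by (rule sum.cong) (use degP in \<open>auto simp: coeffP complex_norm_square[symmetric] simp del: of_real_power\<close>)
  finally have "((\<lambda>x. Re (h (circlepath 0 r x) * cnj (poly P (circlepath 0 r x)))) has_integral ?S) {0..1}"
    unfolding ext by (drule_tac has_integral_Re) simp
  from has_integral_diff[OF has_integral_mult_right[OF this, of 2] poly_int[of P, unfolded ext]]
  have "((\<lambda>x. 2 * Re (h (circlepath 0 r x) * cnj (poly P (circlepath 0 r x))) -
      (norm (poly P (circlepath 0 r x)))\<^sup>2) has_integral ?S) {0..1}"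
    by simp
  moreover have "2 * Re (h (circlepath 0 r x) * cnj (poly P (circlepath 0 r x))) -
      (norm (poly P (circlepath 0 r x)))\<^sup>2 \<le> (norm (poly G (circlepath 0 r x)))\<^sup>2" for x
  proof -
    let ?u = "circlepath 0 r x"
    have "norm ?u = r" using r by (simp add: circlepath norm_mult)
    then have "norm (\<omega> ?u) \<le> 1" using r by (intro bound) simp
    then have "norm (h ?u) \<le> norm (poly G ?u)"
      by (simp add: h_def norm_mult mult_left_le_one_le)
    then have "(norm (h ?u))\<^sup>2 \<le> (norm (poly G ?u))\<^sup>2" by (rule power_mono) simp
    moreover have "0 \<le> (norm (h ?u - poly P ?u))\<^sup>2" by simp
    ultimately show ?thesis
      unfolding cmod_power2 by (simp add: power2_eq_square algebra_simps)
  qed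
  ultimately have "?S \<le> (\<Sum>k\<le>degree G. (norm (coeff G k))\<^sup>2 * r ^ (2 * k))"
    by (intro has_integral_le[OF _ poly_int[of G]]) auto
  then show ?thesis by (simp add: H_def)
qed

text \<open>The coefficients of \<open>W * G\<close> up to index \<open>n\<close> involve only those
  of \<open>G\<close> up to \<open>n\<close>, so \<open>G\<close> may be truncated to a polynomial.
  Both sides of the estimate on circles are then polynomials in \<open>r\<close>, and
  \<open>r\<close> tends to 1.\<close>

theorem rogosinski_coefficient_inequality:
  assumes "\<omega> holomorphic_on ball 0 1" and "\<And>z. z \<in> ball 0 1 \<Longrightarrow> norm (\<omega> z) \<le> 1"
    and "\<omega> has_fps_expansion W"
  shows "(\<Sum>k\<le>n. (norm (fps_nth (W * G) k))\<^sup>2) \<le> (\<Sum>k\<le>n. (norm (fps_nth G k))\<^sup>2)"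
proof -
  define P where "P = (\<Sum>k\<le>n. monom (fps_nth G k) k)"
  have coeffP: "coeff P k = (if k \<le> n then fps_nth G k else 0)" for k
    by (simp add: P_def coeff_sum)
  have degP: "degree P \<le> n"
    by (rule degree_le) (simp add: coeffP)
  have lim: "((\<lambda>r. \<Sum>k\<le>m. a k * r ^ (2 * k)) \<longlongrightarrow> (\<Sum>k\<le>m. a k)) (at_left 1)"
    for a :: "nat \<Rightarrow> real" and m
    by (auto intro!: tendsto_eq_intros)
  have "\<forall>\<^sub>F r in at_left 1. (0::real) < r \<and> r < 1"
    by (rule eventually_at_leftI[of 0]) auto
  then have "\<forall>\<^sub>F r in at_left 1. (\<Sum>k\<le>n. (norm (fps_nth (W * fps_of_poly P) k))\<^sup>2 * r ^ (2 * k))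
           \<le> (\<Sum>k\<le>degree P. (norm (coeff P k))\<^sup>2 * r ^ (2 * k))"
    by eventually_elim (rule schur_coeff_bound_circle, use assms in auto)
  then have "(\<Sum>k\<le>n. (norm (fps_nth (W * fps_of_poly P) k))\<^sup>2) \<le> (\<Sum>k\<le>degree P. (norm (coeff P k))\<^sup>2)"
    by (intro tendsto_le[OF _ lim lim]) auto
  also have "(\<Sum>k\<le>degree P. (norm (coeff P k))\<^sup>2) = (\<Sum>k\<le>n. (norm (fps_nth G k))\<^sup>2)"
    by (rule sum.mono_neutral_cong_left) (use degP in \<open>auto simp: coeffP intro: le_degree\<close>)
  also have "(\<Sum>k\<le>n. (norm (fps_nth (W * fps_of_poly P) k))\<^sup>2) =
      (\<Sum>k\<le>n. (norm (fps_nth (W * G) k))\<^sup>2)"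
    by (intro sum.cong refl arg_cong[where f = "\<lambda>x. (norm x)\<^sup>2"])
       (auto simp: fps_mult_nth coeffP intro!: sum.cong)
  finally show ?thesis .
qed

section \<open>Taylor coefficients of \<open>f\<close> in terms of the Schwarz function\<close>

lemma fps_mult_nth_numerals:
  fixes A B :: "'a :: comm_ring_1 fps"
  shows "fps_nth (A * B) 1 = fps_nth A 0 * fps_nth B 1 + fps_nth A 1 * fps_nth B 0"
    and "fps_nth (A * B) 2 = fps_nth A 0 * fps_nth B 2 + fps_nth A 1 * fps_nth B 1 + fps_nth A 2 * fps_nth B 0"
    and "fps_nth (A * B) 3 = fps_nth A 0 * fps_nth B 3 + fps_nth A 1 * fps_nth B 2 + fps_nth A 2 * fps_nth B 1 + fps_nth A 3 * fps_nth B 0"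
    and "fps_nth (A * B) 4 = fps_nth A 0 * fps_nth B 4 + fps_nth A 1 * fps_nth B 3 + fps_nth A 2 * fps_nth B 2 + fps_nth A 3 * fps_nth B 1 + fps_nth A 4 * fps_nth B 0"
    and "fps_nth (A * B) 5 = fps_nth A 0 * fps_nth B 5 + fps_nth A 1 * fps_nth B 4 + fps_nth A 2 * fps_nth B 3 + fps_nth A 3 * fps_nth B 2 + fps_nth A 4 * fps_nth B 1 + fps_nth A 5 * fps_nth B 0"
  by (simp_all add: fps_mult_nth eval_nat_numeral sum.atLeast0_atMost_Suc)

text \<open>Clearing the denominator turns the subordination into
  \<open>fps_X * fps_deriv F = F * (1 + W * E)\<close>, where the series \<open>E\<close> of
  \<open>exp (\<omega> z)\<close> is governed by \<open>fps_deriv E = E * fps_deriv W\<close>.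
  Comparing coefficients solves both equations recursively.\<close>

lemma starlike_coefficients:
  assumes f: "classA f" and nz: "\<forall>z\<in>ball 0 1. z \<noteq> 0 \<longrightarrow> f z \<noteq> 0"
    and W: "\<omega> has_fps_expansion W" and W0: "fps_nth W 0 = 0"
    and eq: "\<forall>z\<in>ball 0 1. logderiv_quot f z = wp (\<omega> z)"
  defines "c \<equiv> fps_nth W"
  shows "taylor_coeff f 2 = c 1"
    and "taylor_coeff f 3 = (c 2 + 2 * c 1 ^ 2) / 2"
    and "taylor_coeff f 4 = (c 3 + 7/2 * c 1 * c 2 + 5/2 * c 1 ^ 3) / 3"
    and "taylor_coeff f 5 = (c 4 + 10/3 * c 1 * c 3 + 3/2 * c 2 ^ 2 + 37/6 * c 1 ^ 2 * c 2
           + 5/2 * c 1 ^ 4) / 4"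
proof -
  define F where "F = fps_expansion f 0"
  define E where "E = fps_exp 1 oo W"
  have F: "f has_fps_expansion F"
    unfolding F_def using f by (intro has_fps_expansion_fps_expansion[of "ball 0 1"]) (auto simp: classA_def)
  have "(exp \<circ> \<omega>) has_fps_expansion E"
    unfolding E_def by (intro has_fps_expansion_compose has_fps_expansion_exp1 W W0)
  then have E: "(\<lambda>z. exp (\<omega> z)) has_fps_expansion E" by (simp add: o_def)
  have lhs: "(\<lambda>z. z * deriv f z) has_fps_expansion fps_X * fps_deriv F"
    by (intro fps_expansion_intros F)
  have rhs: "(\<lambda>z. f z * (1 + \<omega> z * exp (\<omega> z))) has_fps_expansion F * (1 + W * E)"
    by (intro fps_expansion_intros F W E)
  have "\<forall>\<^sub>F z in nhds 0. z * deriv f z = f z * (1 + \<omega> z * exp (\<omega> z))"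
  proof -
    have "\<forall>\<^sub>F z in nhds 0. z \<in> ball (0::complex) 1"
      by (rule eventually_nhds_in_open) auto
    then show ?thesis
    proof eventually_elim
      case (elim z)
      show ?case
      proof (cases "z = 0")
        case False
        with elim have "logderiv_quot f z = wp (\<omega> z)" "f z \<noteq> 0"
          using eq nz by blast+
        with False show ?thesis
          by (simp add: logderiv_quot_def wp_def field_simps)
      qed (use f in \<open>simp add: classA_def\<close>)
    qed
  qed
  then have "(\<lambda>z. f z * (1 + \<omega> z * exp (\<omega> z))) has_fps_expansion fps_X * fps_deriv F"
    using lhs has_fps_expansion_cong[OF _ refl] by fast
  then have ode: "fps_X * fps_deriv F = F * (1 + W * E)"
    using rhs by (rule fps_expansion_unique_complex)
  have E': "fps_deriv E = E * fps_deriv W"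
    unfolding E_def by (simp add: fps_compose_deriv W0)
  have E0: "fps_nth E 0 = 1" by (simp add: E_def)
  have F0: "fps_nth F 0 = 0" and F1: "fps_nth F 1 = 1"
    using f by (simp_all add: fps_nth_fps_expansion[OF F] classA_def)
  note nth_simps = fps_mult_nth_numerals fps_X_mult_nth c_def W0 E0 F0 F1
  have e1: "fps_nth E 1 = c 1"
    using arg_cong[OF E', of "\<lambda>A. fps_nth A 0"] by (simp add: nth_simps)
  have e2: "2 * fps_nth E 2 = fps_nth E 1 * c 1 + 2 * c 2"
    using arg_cong[OF E', of "\<lambda>A. fps_nth A 1"] by (simp add: nth_simps algebra_simps del: One_nat_def)
  have e3: "3 * fps_nth E 3 = fps_nth E 2 * c 1 + 2 * fps_nth E 1 * c 2 + 3 * c 3"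
    using arg_cong[OF E', of "\<lambda>A. fps_nth A 2"] by (simp add: nth_simps algebra_simps del: One_nat_def)
  \<comment> \<open>In degree \<open>n\<close> the left side is \<open>n * fps_nth F n\<close>, and
    the summand 1 on the right contributes \<open>fps_nth F n\<close>; the difference leaves the
    factor \<open>n - 1\<close>.\<close>
  have b2: "fps_nth F 2 = c 1"
    using arg_cong[OF ode, of "\<lambda>A. fps_nth A 2"] by (simp add: nth_simps algebra_simps del: One_nat_def)
  have b3: "2 * fps_nth F 3 = fps_nth F 2 * c 1 + (c 2 + c 1 * fps_nth E 1)"
    using arg_cong[OF ode, of "\<lambda>A. fps_nth A 3"] by (simp add: nth_simps algebra_simps del: One_nat_def)
  have b4: "3 * fps_nth F 4 = fps_nth F 3 * c 1 + fps_nth F 2 * (c 2 + c 1 * fps_nth E 1)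
      + (c 3 + c 2 * fps_nth E 1 + c 1 * fps_nth E 2)"
    using arg_cong[OF ode, of "\<lambda>A. fps_nth A 4"] by (simp add: nth_simps algebra_simps del: One_nat_def)
  have b5: "4 * fps_nth F 5 = fps_nth F 4 * c 1 + fps_nth F 3 * (c 2 + c 1 * fps_nth E 1)
      + fps_nth F 2 * (c 3 + c 2 * fps_nth E 1 + c 1 * fps_nth E 2)
      + (c 4 + c 3 * fps_nth E 1 + c 2 * fps_nth E 2 + c 1 * fps_nth E 3)"
    using arg_cong[OF ode, of "\<lambda>A. fps_nth A 5"] by (simp add: nth_simps algebra_simps del: One_nat_def)
  have taylor: "taylor_coeff f k = fps_nth F k" for k
    by (simp add: taylor_coeff_def fps_nth_fps_expansion[OF F])
  have e2': "fps_nth E 2 = c 1 ^ 2 / 2 + c 2"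
    using e2 e1 by (simp add: field_simps power2_eq_square)
  have e3': "fps_nth E 3 = c 1 ^ 3 / 6 + c 1 * c 2 + c 3"
    using e3 unfolding e1 e2' by (simp add: field_simps power2_eq_square power3_eq_cube)
  show 2: "taylor_coeff f 2 = c 1"
    by (simp add: taylor b2)
  show 3: "taylor_coeff f 3 = (c 2 + 2 * c 1 ^ 2) / 2"
    using b3 unfolding b2 e1 taylor by (simp add: field_simps power2_eq_square)
  have "3 * taylor_coeff f 4 = c 3 + 7/2 * c 1 * c 2 + 5/2 * c 1 ^ 3"
    unfolding taylor b4 unfolding b2 e1 e2' 3[unfolded taylor]
    by (simp add: field_simps power2_eq_square power3_eq_cube)
  then show 4: "taylor_coeff f 4 = (c 3 + 7/2 * c 1 * c 2 + 5/2 * c 1 ^ 3) / 3"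
    by (metis nonzero_mult_div_cancel_left zero_neq_numeral)
  have "4 * taylor_coeff f 5 = c 4 + 10/3 * c 1 * c 3 + 3/2 * c 2 ^ 2 + 37/6 * c 1 ^ 2 * c 2
      + 5/2 * c 1 ^ 4"
    unfolding taylor b5 unfolding b2 e1 e2' e3' 3[unfolded taylor] 4[unfolded taylor]
    by (simp add: field_simps power2_eq_square power3_eq_cube power4_eq_xxxx)
  then show "taylor_coeff f 5 = (c 4 + 10/3 * c 1 * c 3 + 3/2 * c 2 ^ 2 + 37/6 * c 1 ^ 2 * c 2
      + 5/2 * c 1 ^ 4) / 4"
    by (metis nonzero_mult_div_cancel_left zero_neq_numeral)
qed

section \<open>Coefficient estimates for Schwarz functions\<close>

text \<open>Rogosinski's inequality for polynomials \<open>G\<close> with constant term 1 and free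
  parameters. Since \<omega> vanishes at 0, multiplication by it raises the index, so
  \<open>n\<close> is taken one above the formal degree of \<open>G\<close>.\<close>

lemma schwarz_rogosinski_inequalities:
  fixes g\<^sub>1 g\<^sub>2 g\<^sub>3 :: complex
  assumes \<omega>: "\<omega> holomorphic_on ball 0 1" "\<And>z. z \<in> ball 0 1 \<Longrightarrow> norm (\<omega> z) \<le> 1"
    and W: "\<omega> has_fps_expansion W" and W0: "fps_nth W 0 = 0"
  defines "c \<equiv> fps_nth W"
  shows "(norm (c 1))\<^sup>2 + (norm (c 2 + g\<^sub>1 * c 1))\<^sup>2 \<le> 1 + (norm g\<^sub>1)\<^sup>2"
    and "(norm (c 1))\<^sup>2 + (norm (c 2 + g\<^sub>1 * c 1))\<^sup>2 + (norm (c 3 + g\<^sub>1 * c 2 + g\<^sub>2 * c 1))\<^sup>2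
           \<le> 1 + (norm g\<^sub>1)\<^sup>2 + (norm g\<^sub>2)\<^sup>2"
    and "(norm (c 1))\<^sup>2 + (norm (c 2 + g\<^sub>1 * c 1))\<^sup>2 + (norm (c 3 + g\<^sub>1 * c 2 + g\<^sub>2 * c 1))\<^sup>2
           + (norm (c 4 + g\<^sub>1 * c 3 + g\<^sub>2 * c 2 + g\<^sub>3 * c 1))\<^sup>2
           \<le> 1 + (norm g\<^sub>1)\<^sup>2 + (norm g\<^sub>2)\<^sup>2 + (norm g\<^sub>3)\<^sup>2"
proof -
  note R = rogosinski_coefficient_inequality[OF \<omega> W]
    have sum_upto: "sum a {..2} = a 0 + a 1 + a 2" "sum a {..3} = a 0 + a 1 + a 2 + a 3"
    "sum a {..4} = a 0 + a 1 + a 2 + a 3 + a 4" for a :: "nat \<Rightarrow> real"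
    by (simp_all add: eval_nat_numeral)
  have coeffs: "coeff (pCons a Q) 1 = coeff Q 0" "coeff (pCons a Q) (numeral k) = coeff Q (pred_numeral k)"
    for a :: complex and Q k
    by (simp_all add: numeral_eq_Suc)
  note nth_simps = fps_mult_nth_numerals sum_upto coeffs c_def W0 add_ac mult_ac
  show "(norm (c 1))\<^sup>2 + (norm (c 2 + g\<^sub>1 * c 1))\<^sup>2 \<le> 1 + (norm g\<^sub>1)\<^sup>2"
    using R[where n = 2 and G = "fps_of_poly [:1, g\<^sub>1:]"]
    by (simp add: nth_simps del: One_nat_def)
  show "(norm (c 1))\<^sup>2 + (norm (c 2 + g\<^sub>1 * c 1))\<^sup>2 + (norm (c 3 + g\<^sub>1 * c 2 + g\<^sub>2 * c 1))\<^sup>2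
           \<le> 1 + (norm g\<^sub>1)\<^sup>2 + (norm g\<^sub>2)\<^sup>2"
    using R[where n = 3 and G = "fps_of_poly [:1, g\<^sub>1, g\<^sub>2:]"]
    by (simp add: nth_simps del: One_nat_def)
  show "(norm (c 1))\<^sup>2 + (norm (c 2 + g\<^sub>1 * c 1))\<^sup>2 + (norm (c 3 + g\<^sub>1 * c 2 + g\<^sub>2 * c 1))\<^sup>2
           + (norm (c 4 + g\<^sub>1 * c 3 + g\<^sub>2 * c 2 + g\<^sub>3 * c 1))\<^sup>2
           \<le> 1 + (norm g\<^sub>1)\<^sup>2 + (norm g\<^sub>2)\<^sup>2 + (norm g\<^sub>3)\<^sup>2"
    using R[where n = 4 and G = "fps_of_poly [:1, g\<^sub>1, g\<^sub>2, g\<^sub>3:]"]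
    by (simp add: nth_simps del: One_nat_def)
qed

text \<open>This is the Schwarz-Pick estimate at 0 for \<omega>(z)/z, here obtained from
  Rogosinski's inequality with one free parameter.\<close>

lemma schwarz_second_coefficient_bound:
  assumes \<omega>: "\<omega> holomorphic_on ball 0 1" "\<And>z. z \<in> ball 0 1 \<Longrightarrow> norm (\<omega> z) \<le> 1"
    and W: "\<omega> has_fps_expansion W" and W0: "fps_nth W 0 = 0"
  shows "norm (fps_nth W 2) \<le> 1 - (norm (fps_nth W 1))\<^sup>2"
proof -
  define p where "p = (norm (fps_nth W 1))\<^sup>2"
  define y where "y = norm (fps_nth W 2)"
  \<comment> \<open>The choice \<open>g\<^sub>1 = t c\<^sub>2 cnj c\<^sub>1\<close> is the optimal one in Rogosinski's inequality.\<close>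
  define t where "t = (if p = 1 then 0 else 1 / (1 - p))"
  note R = schwarz_rogosinski_inequalities(1)[OF \<omega> W W0]
  \<comment> \<open>The parameter value 0 gives \<open>p \<le> 1\<close>, and for
    \<open>p = 1\<close> it already forces \<open>y = 0\<close>.\<close>
  have p: "0 \<le> p" "p + y\<^sup>2 \<le> 1"
    using R[of 0] by (simp_all add: p_def y_def)
  have *: "fps_nth W 1 * cnj (fps_nth W 1) = of_real p"
    by (metis p_def complex_norm_square)
  have "fps_nth W 2 + (of_real t * fps_nth W 2 * cnj (fps_nth W 1)) * fps_nth W 1 =
      fps_nth W 2 * of_real (1 + t * p)"
    using * by (simp add: algebra_simps)
  then have "p + (y * (1 + t * p))\<^sup>2 \<le> 1 + t\<^sup>2 * y\<^sup>2 * p"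
    using R[of "of_real t * fps_nth W 2 * cnj (fps_nth W 1)"]
    by (simp add: p_def[symmetric] y_def[symmetric] norm_mult power_mult_distrib
        del: of_real_add of_real_mult One_nat_def)
  then show ?thesis
  proof (cases "p = 1")
    case True
    with p show ?thesis by (simp add: p_def y_def)
  next
    case False
    then have "p < 1" using p zero_le_power2[of y] by linarith
    \<comment> \<open>By \<open>1 + t * p = t\<close> the terms in \<open>(y * t)\<^sup>2\<close>
      combine with factor \<open>1 - p\<close>, which then cancels.\<close>
    then have t: "t * (1 - p) = 1" "1 + t * p = t" by (simp_all add: t_def field_simps)
    have "y\<^sup>2 * t\<^sup>2 * (1 - p) \<le> 1 - p"
      using \<open>p + (y * (1 + t * p))\<^sup>2 \<le> _\<close> unfolding t by (simp add: algebra_simps power_mult_distrib)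
    then have "(y * t)\<^sup>2 \<le> 1"
      using \<open>p < 1\<close> by (simp add: power_mult_distrib)
    then have "\<bar>y * t\<bar> \<le> 1" by (simp only: abs_square_le_1)
    then have "y * t \<le> 1" by linarith
    then have "y \<le> 1 - p" using \<open>p < 1\<close> by (simp add: t_def field_simps)
    then show ?thesis by (simp add: p_def y_def)
  qed
qed

lemma norm_le_iff_power2: "0 \<le> b \<Longrightarrow> norm a \<le> b \<longleftrightarrow> (norm a)\<^sup>2 \<le> b\<^sup>2" for a :: complex
  using abs_le_square_iff[of "norm a" b] by simp

text \<open>The expressions are the numerators from \<open>starlike_coefficients\<close>; each bound
  is attained for \<omega>(z) = z.\<close>

lemma schwarz_functional_bounds:
  assumes \<omega>: "\<omega> holomorphic_on ball 0 1" "\<And>z. z \<in> ball 0 1 \<Longrightarrow> norm (\<omega> z) \<le> 1"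
    and W: "\<omega> has_fps_expansion W" and W0: "fps_nth W 0 = 0"
  defines "c \<equiv> fps_nth W"
  shows "norm (c 1) \<le> 1"
    and "norm (c 2 + 2 * c 1 ^ 2) \<le> 2"
    and "norm (c 3 + 7/2 * c 1 * c 2 + 5/2 * c 1 ^ 3) \<le> 5/2"
    and "norm (c 4 + 10/3 * c 1 * c 3 + 3/2 * c 2 ^ 2 + 37/6 * c 1 ^ 2 * c 2 + 5/2 * c 1 ^ 4) \<le> 5/2"
proof -
  define p where "p = (norm (c 1))\<^sup>2"
  define y where "y = norm (c 2)"
  note R = schwarz_rogosinski_inequalities[OF \<omega> W W0, folded c_def, folded p_def]
  have y: "0 \<le> y" "0 \<le> p" "y \<le> 1 - p"
    using schwarz_second_coefficient_bound[OF \<omega> W W0] by (simp_all add: y_def p_def c_def)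
  then have "p \<le> 1" by linarith
  then show c1: "norm (c 1) \<le> 1"
    by (simp add: p_def abs_square_le_1)
  \<comment> \<open>The right side comes from \<open>1 + 4 * p\<close> after subtracting the term
    \<open>p\<close> on the left.\<close>
  have "(norm (c 2 + 2 * c 1 ^ 2))\<^sup>2 \<le> 1 + 3 * p"
    using R(1)[of "2 * c 1"]
    by (simp add: power2_eq_square[of "c 1"] mult.assoc norm_mult power_mult_distrib p_def[symmetric]
        del: One_nat_def)
  then show "norm (c 2 + 2 * c 1 ^ 2) \<le> 2"
    using \<open>p \<le> 1\<close> by (subst norm_le_iff_power2) auto
  \<comment> \<open>Splitting 7/2 as 5/2 + 1 makes \<open>g\<^sub>2\<close> equal to
    \<open>c 2 + g\<^sub>1 * c 1\<close>, so their squares cancel and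
    \<open>1 + 25/4 * p - p\<close> remains.\<close>
  have b4: "c 3 + 7/2 * c 1 * c 2 + 5/2 * c 1 ^ 3 =
      c 3 + (5/2 * c 1) * c 2 + (c 2 + 5/2 * c 1 * c 1) * c 1"
    by (simp add: algebra_simps power3_eq_cube)
  have "(norm (c 3 + 7/2 * c 1 * c 2 + 5/2 * c 1 ^ 3))\<^sup>2 \<le> 1 + 21/4 * p"
    unfolding b4 using R(2)[of "5/2 * c 1" "c 2 + 5/2 * c 1 * c 1"]
    by (simp add: norm_mult power_mult_distrib p_def[symmetric] power_divide del: One_nat_def times_divide_eq_left times_divide_eq_right)
  then show "norm (c 3 + 7/2 * c 1 * c 2 + 5/2 * c 1 ^ 3) \<le> 5/2"
    using \<open>p \<le> 1\<close> by (subst norm_le_iff_power2) (auto simp: power2_eq_square[of "5/2"])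

  \<comment> \<open>Here \<open>A = [z\<^sup>3] \<omega> G\<close> for \<open>G = 1 + 7/3 c\<^sub>1 z + g2 z\<^sup>2 + (A - d) z\<^sup>3\<close>: the coefficient of \<open>z\<^sup>3\<close> in \<open>G\<close>
    almost cancels against the one in \<open>\<omega> G\<close>, and \<open>Q\<close> collects the lower-order terms.\<close>
  define g2 where "g2 = 3/2 * c 2 + 5/2 * c 1 ^ 2"
  define A where "A = c 3 + (7/3 * c 1) * c 2 + g2 * c 1"
  define d where "d = c 1 * c 2 / 6"
  define Q where "Q = 1 + 40/9 * p + (norm g2)\<^sup>2 - (norm (c 2 + 7/3 * c 1 ^ 2))\<^sup>2"
  have "(norm g2)\<^sup>2 - (norm (c 2 + 7/3 * c 1 ^ 2))\<^sup>2 =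
      5/4 * y\<^sup>2 + 29/36 * p\<^sup>2 + 17/6 * Re (c 2 * cnj (c 1 ^ 2))"
  proof -
    have "(norm (3/2 * u + 5/2 * v))\<^sup>2 - (norm (u + 7/3 * v))\<^sup>2 =
        5/4 * (norm u)\<^sup>2 + 29/36 * (norm v)\<^sup>2 + 17/6 * Re (u * cnj v)" for u v
      unfolding cmod_power2 by (simp add: power2_eq_square field_simps)
    from this[of "c 2" "c 1 ^ 2"] show ?thesis
      by (simp add: g2_def y_def p_def norm_power)
  qed
  moreover have "Re (c 2 * cnj (c 1 ^ 2)) \<le> y * p"
    using complex_Re_le_cmod[of "c 2 * cnj (c 1 ^ 2)"]
    by (simp add: norm_mult norm_power y_def p_def)
  ultimately have Q: "Q \<le> 1 + 40/9 * p + 5/4 * y\<^sup>2 + 29/36 * p\<^sup>2 + 17/6 * (y * p)"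
    by (simp add: Q_def)
  \<comment> \<open>All coefficients in the bound for \<open>Q\<close> are nonnegative, so
    \<open>p\<close> may be replaced by \<open>1 - y\<close>, leaving one variable.\<close>
  have "p \<le> 1 - y" "p\<^sup>2 \<le> (1 - y)\<^sup>2" "y * p \<le> y * (1 - y)"
    using y by (auto intro!: power_mono mult_left_mono)
  with Q have "Q \<le> 1 + 40/9 * (1 - y) + 5/4 * y\<^sup>2 + 29/36 * (1 - y)\<^sup>2 + 17/6 * (y * (1 - y))"
    using y by (elim order_trans) (intro add_mono mult_left_mono; simp)
  \<comment> \<open>The constant term is exactly 25/4. The split-off
    \<open>5/6 * y + y\<^sup>2 / 36\<close> will pay for replacing \<open>A\<close> by
    \<open>A - d\<close>.\<close>
  also have "\<dots> = 25/4 - 43/18 * y - 3/4 * y\<^sup>2 - 5/6 * y - y\<^sup>2 / 36"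
    by (simp add: power2_eq_square field_simps)
  finally have Q': "Q + 5/6 * y + y\<^sup>2 / 36 \<le> 25/4"
    using y zero_le_power2[of y] by linarith
  have g1: "(norm (7/3 * c 1))\<^sup>2 = 49/9 * p" "7/3 * c 1 * c 1 = 7/3 * c 1 ^ 2"
    by (simp_all add: norm_mult power_mult_distrib power_divide p_def power2_eq_square)
  \<comment> \<open>\<open>Q\<close> is what the inequality of the next lower order leaves for the
    square of \<open>norm A\<close>.\<close>
  have "(norm A)\<^sup>2 \<le> Q"
    using R(2)[of "7/3 * c 1" g2, unfolded g1, folded A_def] unfolding Q_def by linarith
  also have "Q \<le> 25/4" using Q' y zero_le_power2[of y] by linarith
  finally have A: "norm A \<le> 5/2"
    by (subst norm_le_iff_power2) (auto simp: power2_eq_square[of "5/2"])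
  have d: "norm d \<le> y / 6"
    using c1 by (simp add: d_def norm_mult norm_divide y_def mult_left_le_one_le)
  have "(norm (A - d))\<^sup>2 \<le> (norm A + norm d)\<^sup>2"
    by (intro power_mono norm_triangle_ineq4) auto
  also have "\<dots> = (norm A)\<^sup>2 + 2 * (norm A * norm d) + (norm d)\<^sup>2"
    by (simp add: power2_sum)
  also have "\<dots> \<le> (norm A)\<^sup>2 + 2 * (5/2 * (y / 6)) + (y / 6)\<^sup>2"
    using A d by (intro add_mono mult_left_mono mult_mono power_mono) auto
  finally have Ad: "(norm (A - d))\<^sup>2 \<le> (norm A)\<^sup>2 + 5/6 * y + y\<^sup>2 / 36"
    by (simp add: power_divide)
  \<comment> \<open>Matching \<open>c 1 * c 3\<close>, \<open>c 2 ^ 2\<close> and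
    \<open>c 1 ^ 4\<close> dictates 7/3, 3/2 and 5/2. These produce 38/6 for
    \<open>c 1 ^ 2 * c 2\<close>, and \<open>d\<close> removes the excess 1/6.\<close>
  have "c 4 + 10/3 * c 1 * c 3 + 3/2 * c 2 ^ 2 + 37/6 * c 1 ^ 2 * c 2 + 5/2 * c 1 ^ 4 =
      c 4 + (7/3 * c 1) * c 3 + g2 * c 2 + (A - d) * c 1" (is "?L = ?R")
    by (simp add: g2_def A_def d_def field_simps power2_eq_square power4_eq_xxxx)
  then have "(norm ?L)\<^sup>2 = (norm ?R)\<^sup>2" by (rule arg_cong)
  also have "\<dots> \<le> Q + (norm (A - d))\<^sup>2 - (norm A)\<^sup>2"
    using R(3)[of "7/3 * c 1" g2 "A - d", unfolded g1, folded A_def] unfolding Q_def by linarith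
  also have "\<dots> \<le> (5/2)\<^sup>2"
    using Ad Q' by (simp add: power2_eq_square[of "5/2"])
  finally show "norm ?L \<le> 5/2"
    by (subst norm_le_iff_power2) auto
qed

section \<open>Coefficient bounds for the class and the extremal function\<close>

theorem mainTheorem15:
  shows "(\<forall>f. starlike_wp f \<longrightarrow>
            norm (taylor_coeff f 2) \<le> 1 \<and> norm (taylor_coeff f 3) \<le> 1 \<and>
            norm (taylor_coeff f 4) \<le> 5/6 \<and> norm (taylor_coeff f 5) \<le> 5/8)
       \<and> (let f1 = (\<lambda>z. z * exp (exp z - 1)) in
            starlike_wp f1 \<and> taylor_coeff f1 2 = 1 \<and> taylor_coeff f1 3 = 1 \<and>
            taylor_coeff f1 4 = 5/6 \<and> taylor_coeff f1 5 = 5/8)"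
proof (intro conjI allI impI)
  fix f assume f: "starlike_wp f"
  then obtain \<omega> where \<omega>: "\<omega> holomorphic_on ball 0 1" "\<omega> ` ball 0 1 \<subseteq> ball 0 1" "\<omega> 0 = 0"
    and eq: "\<forall>z\<in>ball 0 1. logderiv_quot f z = wp (\<omega> z)"
    by (auto simp: starlike_wp_def subordinate_def)
  define W where "W = fps_expansion \<omega> 0"
  have W: "\<omega> has_fps_expansion W"
    unfolding W_def using \<omega>(1) by (intro has_fps_expansion_fps_expansion[of "ball 0 1"]) auto
  have W0: "fps_nth W 0 = 0"
    by (simp add: fps_nth_fps_expansion[OF W] \<omega>(3))
  have bound: "norm (\<omega> z) \<le> 1" if "z \<in> ball 0 1" for z
    using \<omega>(2) that by (force simp: image_subset_iff)
  note B = schwarz_functional_bounds[OF \<omega>(1) bound W W0]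
  have "classA f" "\<forall>z\<in>ball 0 1. z \<noteq> 0 \<longrightarrow> f z \<noteq> 0"
    using f by (auto simp: starlike_wp_def)
  note T = starlike_coefficients[OF this W W0 eq]
  show "norm (taylor_coeff f 2) \<le> 1" "norm (taylor_coeff f 3) \<le> 1"
    "norm (taylor_coeff f 4) \<le> 5/6" "norm (taylor_coeff f 5) \<le> 5/8"
    unfolding T norm_divide using B by simp_all
next
  define f1 :: "complex \<Rightarrow> complex" where "f1 = (\<lambda>z. z * exp (exp z - 1))"
  have deriv_f1: "deriv f1 z = exp (exp z - 1) * (1 + z * exp z)" for z
    unfolding f1_def
    by (rule DERIV_imp_deriv) (auto intro!: derivative_eq_intros simp: algebra_simps)
  have nz: "\<forall>z\<in>ball 0 1. z \<noteq> 0 \<longrightarrow> f1 z \<noteq> 0"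
    by (simp add: f1_def)
  have A: "classA f1"
    unfolding classA_def deriv_f1 by (auto simp: f1_def intro!: holomorphic_intros)
  have eq: "\<forall>z\<in>ball 0 1. logderiv_quot f1 z = wp z"
    by (simp add: logderiv_quot_def wp_def deriv_f1) (simp add: f1_def)
  have S: "starlike_wp f1"
    unfolding starlike_wp_def subordinate_def
    using A nz eq by (auto intro!: exI[of _ "\<lambda>z. z"] holomorphic_intros)
  \<comment> \<open>Here \<omega> is the identity with series \<open>fps_X\<close>, so only the pure
    powers of \<open>c 1 = 1\<close> survive in the coefficient formulas.\<close>
  have "taylor_coeff f1 2 = 1" "taylor_coeff f1 3 = 1"
    "taylor_coeff f1 4 = 5/6" "taylor_coeff f1 5 = 5/8"
    using starlike_coefficients[OF A nz has_fps_expansion_fps_X _ eq] by simp_all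
  with S show "let f1 = (\<lambda>z. z * exp (exp z - 1)) in
            starlike_wp f1 \<and> taylor_coeff f1 2 = 1 \<and> taylor_coeff f1 3 = 1 \<and>
            taylor_coeff f1 4 = 5/6 \<and> taylor_coeff f1 5 = 5/8"
    by (simp add: f1_def)
qed

end
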